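(* Let $\rho,\rho',\sigma$ be quantum states on a finite-dimensional Hilbert space such that $\rho$ and $\rho'$ both commute with $\sigma$ (but not necessarily with each other). Then there exists a unitary channel $\mathcal U$ such that (i) $[\rho,\mathcal U(\rho')]=0$, (ii) $D(\rho,\mathcal U(\rho'))\le D(\rho,\rho')$, and (iii) $\mathcal U(\rho')$ commutes with $\sigma$.
   Context: $D(\rho,\tau)=\frac12\|\rho-\tau\|_1$ is the trace distance; a unitary channel is a map $X\mapsto UXU^\dagger$ with $U$ unitary. *)

theory Defs
  imports "Jordan_Normal_Form.Schur_Decomposition" "HOL-Computational_Algebra.Fundamental_Theorem_Algebra"
begin

(* Hermitian n x n complex matrix *)
definition hermitian_mat :: "nat \<Rightarrow> complex mat \<Rightarrow> bool" where
  "hermitian_mat n A \<longleftrightarrow> A \<in> carrier_mat n n \<and> mat_adjoint A = A"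

(* positive semidefinite: Hermitian with <v, A v> >= 0 for all v *)
definition psd_mat :: "nat \<Rightarrow> complex mat \<Rightarrow> bool" where
  "psd_mat n A \<longleftrightarrow> hermitian_mat n A \<and>
     (\<forall>v \<in> carrier_vec n. 0 \<le> Re ((A *\<^sub>v v) \<bullet>c v))"

definition mat_trace :: "complex mat \<Rightarrow> complex" where
  "mat_trace A = (\<Sum>i<dim_row A. A $$ (i, i))"

(* quantum state (density matrix) on C^n *)
definition density_mat :: "nat \<Rightarrow> complex mat \<Rightarrow> bool" where
  "density_mat n \<rho> \<longleftrightarrow> psd_mat n \<rho> \<and> mat_trace \<rho> = 1"

definition unitary_mat :: "nat \<Rightarrow> complex mat \<Rightarrow> bool" where
  "unitary_mat n U \<longleftrightarrow> U \<in> carrier_mat n n \<and> U * mat_adjoint U = 1\<^sub>m n \<and> mat_adjoint U * U = 1\<^sub>m n"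

(* unitary channel X \<mapsto> U X U^\<dagger> *)
definition unitary_channel :: "complex mat \<Rightarrow> complex mat \<Rightarrow> complex mat" where
  "unitary_channel U X = U * X * mat_adjoint U"

(* trace norm = sum of singular values, i.e. of square roots of the eigenvalues
   (with algebraic multiplicity) of A^\<dagger> A *)
definition trace_norm :: "complex mat \<Rightarrow> real" where
  "trace_norm A = (\<Sum>x \<in># proots (char_poly (mat_adjoint A * A)). sqrt (Re x))"

(* trace distance D(\<rho>,\<tau>) = 1/2 ||\<rho> - \<tau>||_1 *)
definition trace_dist :: "complex mat \<Rightarrow> complex mat \<Rightarrow> real" where
  "trace_dist \<rho> \<tau> = trace_norm (\<rho> - \<tau>) / 2"

end

(*
  Let C = rho - rho' and let P be its negative part, taken in a common eigenbasis of C and sigma,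
  so that P >= 0 commutes with sigma and tr C + 2 tr P = ||C||_1. Then D = rho + P = rho' + (C + P)
  dominates both rho and rho' in the Loewner order and commutes with sigma.

  Diagonalise each of rho, rho' and D jointly with sigma, listing the common eigenvectors in
  decreasing order of the eigenvalues of X + K sigma (X = rho, rho', D). Weyl's monotonicity applied
  to rho + K sigma <= D + K sigma gives a_k + K s_k <= d_k + K q_k for the k-th entries. Once K times
  every gap between distinct eigenvalues of sigma exceeds ||rho||_1 + ||D||_1, this forces s_k <= q_k,
  hence s = q since both sum to tr sigma, and then a_k <= d_k; likewise for rho'.

  The unitary U taking the eigenbasis of rho' to that of rho therefore makes U rho' U^dagger diagonal
  in the eigenbasis of rho, with the same sigma-eigenvalue in every slot, so it commutes with rho and
  sigma, and
    ||rho - U rho' U^dagger||_1 = sum |a_k - b_k| <= sum (2 d_k - a_k - b_k) = tr (2 D - rho - rho')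
                                = ||rho - rho'||_1.
*)

theory Submission
  imports Defs "HOL-Combinatorics.List_Permutation"
begin

section \<open>Adjoints and the complex inner product\<close>

lemma dim_row_mat_adjoint[simp]: "dim_row (mat_adjoint A) = dim_col A"
  and dim_col_mat_adjoint[simp]: "dim_col (mat_adjoint A) = dim_row A"
  by (auto simp: mat_adjoint_def mat_of_rows_def)

lemma index_mat_adjoint[simp]:
  "i < dim_col A \<Longrightarrow> j < dim_row A \<Longrightarrow> mat_adjoint (A :: complex mat) $$ (i, j) = cnj (A $$ (j, i))"
  by (auto simp: mat_adjoint_def mat_of_rows_def)

lemma mat_adjoint_carrier[simp]: "A \<in> carrier_mat n m \<Longrightarrow> mat_adjoint A \<in> carrier_mat m n"
  unfolding carrier_mat_def by simp

lemma mat_adjoint_adjoint[simp]: "mat_adjoint (mat_adjoint (A :: complex mat)) = A"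
  by (rule eq_matI) auto

lemma mat_adjoint_mult:
  assumes "(A :: complex mat) \<in> carrier_mat n m" "B \<in> carrier_mat m k"
  shows "mat_adjoint (A * B) = mat_adjoint B * mat_adjoint A"
  using assms by (intro eq_matI) (auto simp: scalar_prod_def mult.commute)

lemma mat_adjoint_add:
  "(A :: complex mat) \<in> carrier_mat n m \<Longrightarrow> B \<in> carrier_mat n m \<Longrightarrow>
    mat_adjoint (A + B) = mat_adjoint A + mat_adjoint B"
  by (intro eq_matI) auto

lemma mat_adjoint_minus:
  "(A :: complex mat) \<in> carrier_mat n m \<Longrightarrow> B \<in> carrier_mat n m \<Longrightarrow>
    mat_adjoint (A - B) = mat_adjoint A - mat_adjoint B"
  by (intro eq_matI) auto

lemma hermitian_mat_carrier: "hermitian_mat n A \<Longrightarrow> A \<in> carrier_mat n n"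
  by (simp add: hermitian_mat_def)

lemma hermitian_mat_add:
  "hermitian_mat n A \<Longrightarrow> hermitian_mat n B \<Longrightarrow> hermitian_mat n (A + B)"
  unfolding hermitian_mat_def by (auto simp: mat_adjoint_add[of _ n n])

lemma hermitian_mat_minus:
  "hermitian_mat n A \<Longrightarrow> hermitian_mat n B \<Longrightarrow> hermitian_mat n (A - B)"
  unfolding hermitian_mat_def by (auto simp: mat_adjoint_minus[of _ n n])

lemma cscalar_prod_eq_sum:
  "x \<in> carrier_vec n \<Longrightarrow> y \<in> carrier_vec n \<Longrightarrow> x \<bullet>c (y :: complex vec) = (\<Sum>i<n. x $ i * cnj (y $ i))"
  by (simp add: scalar_prod_def atLeast0LessThan)

lemma mult_mat_vec_index_sum:
  "A \<in> carrier_mat n m \<Longrightarrow> x \<in> carrier_vec m \<Longrightarrow> i < n \<Longrightarrow> (A *\<^sub>v x) $ i = (\<Sum>k<m. A $$ (i, k) * x $ k)"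
  by (simp add: scalar_prod_def atLeast0LessThan)

lemma cscalar_prod_smult_left:
  "x \<in> carrier_vec n \<Longrightarrow> y \<in> carrier_vec n \<Longrightarrow> (a \<cdot>\<^sub>v x) \<bullet>c y = a * (x \<bullet>c (y :: complex vec))"
  by (simp add: cscalar_prod_eq_sum[of _ n] sum_distrib_left mult_ac)

lemma cscalar_prod_smult_right:
  "x \<in> carrier_vec n \<Longrightarrow> y \<in> carrier_vec n \<Longrightarrow> x \<bullet>c (a \<cdot>\<^sub>v y) = cnj a * (x \<bullet>c (y :: complex vec))"
  by (simp add: cscalar_prod_eq_sum[of _ n] sum_distrib_left mult_ac)

lemma cscalar_prod_minus_left:
  "x \<in> carrier_vec n \<Longrightarrow> y \<in> carrier_vec n \<Longrightarrow> z \<in> carrier_vec n \<Longrightarrow>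
    (x - y) \<bullet>c z = x \<bullet>c z - y \<bullet>c (z :: complex vec)"
  by (simp add: cscalar_prod_eq_sum[of _ n] sum_subtractf algebra_simps)

lemma cscalar_prod_swap:
  "x \<in> carrier_vec n \<Longrightarrow> y \<in> carrier_vec n \<Longrightarrow> x \<bullet>c y = cnj (y \<bullet>c (x :: complex vec))"
  by (simp add: cscalar_prod_eq_sum[of _ n] mult_ac)

lemma cscalar_prod_self:
  "x \<in> carrier_vec n \<Longrightarrow> x \<bullet>c (x :: complex vec) = of_real (\<Sum>i<n. (cmod (x $ i))\<^sup>2)"
  by (simp only: cscalar_prod_eq_sum[of _ n] of_real_sum complex_norm_square)

lemma cscalar_prod_self_pos:
  assumes "x \<in> carrier_vec n" "x \<noteq> 0\<^sub>v n"
  shows "0 < Re (x \<bullet>c (x :: complex vec))"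
  using conjugate_square_greater_0_vec[OF assms(1)] assms(2) by (simp add: less_complex_def)

lemma cscalar_prod_mat_adjoint:
  assumes A: "(A :: complex mat) \<in> carrier_mat n m" and x: "x \<in> carrier_vec m" and y: "y \<in> carrier_vec n"
  shows "(A *\<^sub>v x) \<bullet>c y = x \<bullet>c (mat_adjoint A *\<^sub>v y)"
proof -
  have "(A *\<^sub>v x) \<bullet>c y = (\<Sum>r<n. (\<Sum>k<m. A $$ (r, k) * x $ k) * cnj (y $ r))"
    using A x y by (simp add: cscalar_prod_eq_sum[of _ n] scalar_prod_def atLeast0LessThan)
  also have "\<dots> = (\<Sum>r<n. \<Sum>k<m. x $ k * (A $$ (r, k) * cnj (y $ r)))"
    by (simp add: sum_distrib_left sum_distrib_right mult_ac)
  also have "\<dots> = (\<Sum>k<m. \<Sum>r<n. x $ k * (A $$ (r, k) * cnj (y $ r)))"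
    by (rule sum.swap)
  also have "\<dots> = (\<Sum>k<m. x $ k * cnj (\<Sum>r<n. cnj (A $$ (r, k)) * y $ r))"
    by (simp add: sum_distrib_left)
  also have "\<dots> = x \<bullet>c (mat_adjoint A *\<^sub>v y)"
    using A x y by (simp add: cscalar_prod_eq_sum[of _ m] scalar_prod_def atLeast0LessThan)
  finally show ?thesis .
qed

lemma hermitian_cscalar_prod:
  "hermitian_mat n A \<Longrightarrow> x \<in> carrier_vec n \<Longrightarrow> y \<in> carrier_vec n \<Longrightarrow> (A *\<^sub>v x) \<bullet>c y = x \<bullet>c (A *\<^sub>v y)"
  using cscalar_prod_mat_adjoint[of A n n x y] by (simp add: hermitian_mat_def)

lemma exists_nonzero_kernel_vec:
  assumes M: "(M :: 'a :: idom mat) \<in> carrier_mat m k" and mk: "m < k"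
  shows "\<exists>c\<in>carrier_vec k. c \<noteq> 0\<^sub>v k \<and> M *\<^sub>v c = 0\<^sub>v m"
proof -
  define M' where "M' = mat\<^sub>r k k (\<lambda>i. if i = k - 1 then 0\<^sub>v k else if i < m then row M i else 0\<^sub>v k)"
  have M'c: "M' \<in> carrier_mat k k" unfolding M'_def by auto
  have "det M' = 0" unfolding M'_def
    by (rule det_row_0) (use mk M in auto)
  then obtain c where c: "c \<in> carrier_vec k" "c \<noteq> 0\<^sub>v k" "M' *\<^sub>v c = 0\<^sub>v k"
    using det_0_iff_vec_prod_zero[OF M'c] by auto
  have "(M *\<^sub>v c) $ i = 0" if "i < m" for i
  proof -
    have "i \<noteq> k - 1" using that mk by simp
    then show ?thesis
      using arg_cong[OF c(3), of "\<lambda>v. v $ i"] that mk M c(1) by (simp add: M'_def)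
  qed
  then have "M *\<^sub>v c = 0\<^sub>v m" using M by (intro eq_vecI) auto
  with c show ?thesis by auto
qed

lemma exists_nonzero_orthogonal_vec:
  assumes km: "k < m" and y: "\<And>i. i < k \<Longrightarrow> y i \<in> carrier_vec m"
  shows "\<exists>x\<in>carrier_vec m. x \<noteq> 0\<^sub>v m \<and> (\<forall>i<k. x \<bullet>c y i = (0 :: complex))"
proof -
  define M where "M = mat k m (\<lambda>(i, r). cnj (y i $ r))"
  obtain x where x: "x \<in> carrier_vec m" "x \<noteq> 0\<^sub>v m" "M *\<^sub>v x = 0\<^sub>v k"
    using exists_nonzero_kernel_vec[of M k m] km by (auto simp: M_def)
  have "x \<bullet>c y i = (M *\<^sub>v x) $ i" if "i < k" for i
    using that x(1) y[OF that]
      by (simp add: M_def cscalar_prod_eq_sum[of _ m] scalar_prod_def atLeast0LessThan mult.commute)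
  with x show ?thesis by auto
qed

section \<open>Eigenvectors in invariant subspaces\<close>

definition subspace_of :: "nat \<Rightarrow> 'a :: comm_ring_1 vec set \<Rightarrow> bool" where
  "subspace_of n W \<longleftrightarrow> W \<subseteq> carrier_vec n \<and> (\<forall>x\<in>W. \<forall>y\<in>W. x - y \<in> W) \<and> (\<forall>c. \<forall>x\<in>W. c \<cdot>\<^sub>v x \<in> W)"

primrec apply_lin_factors :: "'a :: comm_ring_1 mat \<Rightarrow> (nat \<Rightarrow> 'a) \<Rightarrow> nat \<Rightarrow> 'a vec \<Rightarrow> 'a vec" where
  "apply_lin_factors A r 0 v = v"
| "apply_lin_factors A r (Suc m) v =
     A *\<^sub>v apply_lin_factors A r m v - r m \<cdot>\<^sub>v apply_lin_factors A r m v"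

lemma apply_lin_factors_carrier:
  "A \<in> carrier_mat n n \<Longrightarrow> v \<in> carrier_vec n \<Longrightarrow> apply_lin_factors A r m v \<in> carrier_vec n"
  by (induction m) auto

lemma apply_lin_factors_in_subspace:
  assumes "subspace_of n W" "\<And>x. x \<in> W \<Longrightarrow> A *\<^sub>v x \<in> W" "v \<in> W"
  shows "apply_lin_factors A r m v \<in> W"
  using assms by (induction m) (auto simp: subspace_of_def)

lemma coeff_mult_linear_factor:
  fixes p :: "'a :: comm_ring_1 poly"
  shows "coeff (p * [:b, 1:]) i = b * coeff p i + (case i of 0 \<Rightarrow> 0 | Suc j \<Rightarrow> coeff p j)"
proof -
  have "p * [:b, 1:] = smult b p + pCons 0 p"
    by (simp add: mult.commute mult_pCons_left smult_1_left)
  then show ?thesis by (simp add: coeff_pCons split: nat.splits)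
qed

lemma apply_lin_factors_eq_sum_coeff:
  fixes A :: "'a :: idom mat"
  assumes A: "A \<in> carrier_mat n n" and v: "v \<in> carrier_vec n" and i: "i < n"
  shows "apply_lin_factors A r m v $ i =
    (\<Sum>j\<le>m. coeff (\<Prod>l<m. [:- r l, 1:]) j * (((*\<^sub>v) A ^^ j) v) $ i)"
  using i
proof (induction m arbitrary: i)
  case 0
  then show ?case by simp
next
  case (Suc m)
  let ?p = "\<Prod>l<m. [:- r l, 1:]"
  let ?K = "\<lambda>j. ((*\<^sub>v) A ^^ j) v"
  have K: "?K j \<in> carrier_vec n" for j
    using A v by (induction j) auto
  have "degree ?p = (\<Sum>l<m. degree [:- r l, 1:])"
    by (rule degree_prod_eq_sum_degree) auto
  then have "degree ?p = m" by simp
  then have top: "coeff ?p (Suc m) = 0"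
    by (simp add: coeff_eq_0)
  have "(\<Sum>j\<le>Suc m. coeff (?p * [:- r m, 1:]) j * ?K j $ i)
      = - r m * (\<Sum>j\<le>Suc m. coeff ?p j * ?K j $ i)
        + (\<Sum>j\<le>Suc m. (case j of 0 \<Rightarrow> 0 | Suc j' \<Rightarrow> coeff ?p j') * ?K j $ i)"
    unfolding coeff_mult_linear_factor sum_distrib_left sum.distrib[symmetric]
    by (intro sum.cong) (auto simp: algebra_simps)
  also have "(\<Sum>j\<le>Suc m. coeff ?p j * ?K j $ i) = apply_lin_factors A r m v $ i"
    using Suc top by simp
  also have "(\<Sum>j\<le>Suc m. (case j of 0 \<Rightarrow> 0 | Suc j' \<Rightarrow> coeff ?p j') * ?K j $ i)
      = (\<Sum>j\<le>m. coeff ?p j * (A *\<^sub>v ?K j) $ i)"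
    by (subst sum.atMost_Suc_shift) simp
  also have "\<dots> = (\<Sum>j\<le>m. \<Sum>k<n. A $$ (i, k) * (coeff ?p j * ?K j $ k))"
    using Suc.prems
    by (intro sum.cong refl) (simp add: mult_mat_vec_index_sum[OF A K] sum_distrib_left mult_ac)
  also have "\<dots> = (\<Sum>k<n. A $$ (i, k) * (\<Sum>j\<le>m. coeff ?p j * ?K j $ k))"
    by (subst sum.swap) (simp add: sum_distrib_left)
  also have "\<dots> = (\<Sum>k<n. A $$ (i, k) * apply_lin_factors A r m v $ k)"
    using Suc.IH by simp
  also have "\<dots> = (A *\<^sub>v apply_lin_factors A r m v) $ i"
    by (rule mult_mat_vec_index_sum[OF A apply_lin_factors_carrier[OF A v] Suc.prems, symmetric])
  finally have expand: "(\<Sum>j\<le>Suc m. coeff (?p * [:- r m, 1:]) j * ?K j $ i)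
      = - r m * apply_lin_factors A r m v $ i + (A *\<^sub>v apply_lin_factors A r m v) $ i" .
  have prod: "(\<Prod>l<Suc m. [:- r l, 1:]) = ?p * [:- r m, 1:]"
    by simp
  show ?case
    unfolding prod expand using Suc.prems apply_lin_factors_carrier[OF A v, of r m] A by simp
qed

lemma lin_factors_annihilate_imp_eigenvector:
  assumes A: "A \<in> carrier_mat n n" and v: "v \<in> carrier_vec n" "v \<noteq> 0\<^sub>v n"
    and zero: "apply_lin_factors A r m v = 0\<^sub>v n"
  shows "\<exists>j<m. apply_lin_factors A r j v \<noteq> 0\<^sub>v n \<and>
    A *\<^sub>v apply_lin_factors A r j v = r j \<cdot>\<^sub>v apply_lin_factors A r j v"
  using zero
proof (induction m)
  case 0
  with v show ?case by simp
next
  case (Suc m)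
  let ?x = "apply_lin_factors A r m v"
  show ?case
  proof (cases "?x = 0\<^sub>v n")
    case True
    with Suc.IH show ?thesis by (meson less_SucI)
  next
    case False
    have x: "?x \<in> carrier_vec n" using A v(1) by (rule apply_lin_factors_carrier)
    have "A *\<^sub>v ?x = r m \<cdot>\<^sub>v ?x"
    proof (rule eq_vecI)
      fix i assume "i < dim_vec (r m \<cdot>\<^sub>v ?x)"
      then show "(A *\<^sub>v ?x) $ i = (r m \<cdot>\<^sub>v ?x) $ i"
        using arg_cong[OF Suc.prems, of "\<lambda>w. w $ i"] A x by simp
    qed (use A x in simp)
    with False show ?thesis by blast
  qed
qed

lemma krylov_relation:
  fixes A :: "'a :: idom mat"
  assumes A: "A \<in> carrier_mat n n" and v: "v \<in> carrier_vec n"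
  shows "\<exists>q. q \<noteq> 0 \<and> degree q \<le> n \<and>
    (\<forall>i<n. (\<Sum>j\<le>n. coeff q j * (((*\<^sub>v) A ^^ j) v) $ i) = 0)"
proof -
  define K where "K = mat n (Suc n) (\<lambda>(i, j). (((*\<^sub>v) A ^^ j) v) $ i)"
  obtain c where c: "c \<in> carrier_vec (Suc n)" "c \<noteq> 0\<^sub>v (Suc n)" "K *\<^sub>v c = 0\<^sub>v n"
    using exists_nonzero_kernel_vec[of K n "Suc n"] by (auto simp: K_def)
  define q where "q = (\<Sum>j\<le>n. monom (c $ j) j)"
  have coeff_q: "coeff q j = (if j \<le> n then c $ j else 0)" for j
    by (simp add: q_def coeff_sum coeff_monom)
  obtain j where "j \<le> n" "c $ j \<noteq> 0"
    using c(1,2) by (metis eq_vecI index_zero_vec(1,2) carrier_vecD less_Suc_eq_le)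
  then have "q \<noteq> 0"
    by (metis coeff_0 coeff_q)
  moreover have "degree q \<le> n"
    by (rule degree_le) (simp add: coeff_q)
  moreover have "(\<Sum>j\<le>n. coeff q j * (((*\<^sub>v) A ^^ j) v) $ i) = 0" if "i < n" for i
    using arg_cong[OF c(3), of "\<lambda>w. w $ i"] that c(1)
    by (simp add: K_def coeff_q scalar_prod_def atLeast0LessThan lessThan_Suc_atMost mult.commute)
  ultimately show ?thesis by blast
qed

lemma invariant_subspace_has_eigenvector:
  fixes A :: "complex mat"
  assumes A: "A \<in> carrier_mat n n" and W: "subspace_of n W"
    and inv: "\<And>x. x \<in> W \<Longrightarrow> A *\<^sub>v x \<in> W" and v: "v \<in> W" "v \<noteq> 0\<^sub>v n"
  shows "\<exists>u\<in>W. \<exists>\<mu>. u \<noteq> 0\<^sub>v n \<and> A *\<^sub>v u = \<mu> \<cdot>\<^sub>v u"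
proof -
  have vc: "v \<in> carrier_vec n" using W v by (auto simp: subspace_of_def)
  obtain q where q: "q \<noteq> 0" "degree q \<le> n"
    and rel: "\<And>i. i < n \<Longrightarrow> (\<Sum>j\<le>n. coeff q j * (((*\<^sub>v) A ^^ j) v) $ i) = 0"
    using krylov_relation[OF A vc] by blast
  \<comment> \<open>Some partial product of the linear factors of q, applied to v, is an eigenvector.\<close>
  obtain r where r: "smult (lead_coeff q) (\<Prod>l<degree q. [:- r l, 1:]) = q"
    using complex_poly_decompose' by blast
  have "apply_lin_factors A r (degree q) v = 0\<^sub>v n"
  proof (rule eq_vecI)
    fix i assume "i < dim_vec (0\<^sub>v n :: complex vec)"
    then have i: "i < n" by simp
    have "lead_coeff q * apply_lin_factors A r (degree q) v $ i
        = (\<Sum>j\<le>degree q. coeff q j * (((*\<^sub>v) A ^^ j) v) $ i)"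
      unfolding apply_lin_factors_eq_sum_coeff[OF A vc i] sum_distrib_left
      by (subst (2) r[symmetric]) (simp add: mult.assoc)
    also have "\<dots> = (\<Sum>j\<le>n. coeff q j * (((*\<^sub>v) A ^^ j) v) $ i)"
      by (rule sum.mono_neutral_left) (use q(2) in \<open>auto simp: coeff_eq_0\<close>)
    also have "\<dots> = 0" using rel[OF i] .
    finally show "apply_lin_factors A r (degree q) v $ i = 0\<^sub>v n $ i"
      using q(1) i by simp
  qed (use apply_lin_factors_carrier[OF A vc] in auto)
  then obtain j where "apply_lin_factors A r j v \<noteq> 0\<^sub>v n"
    "A *\<^sub>v apply_lin_factors A r j v = r j \<cdot>\<^sub>v apply_lin_factors A r j v"
    using lin_factors_annihilate_imp_eigenvector[OF A vc v(2)] by blast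
  moreover have "apply_lin_factors A r j v \<in> W"
    using W inv v(1) by (rule apply_lin_factors_in_subspace)
  ultimately show ?thesis by blast
qed

lemma invariant_subspace_has_common_eigenvector:
  fixes A B :: "complex mat"
  assumes A: "A \<in> carrier_mat n n" and B: "B \<in> carrier_mat n n" and AB: "A * B = B * A"
    and W: "subspace_of n W" and invA: "\<And>x. x \<in> W \<Longrightarrow> A *\<^sub>v x \<in> W"
    and invB: "\<And>x. x \<in> W \<Longrightarrow> B *\<^sub>v x \<in> W" and v: "v \<in> W" "v \<noteq> 0\<^sub>v n"
  shows "\<exists>u\<in>W. \<exists>\<alpha> \<beta>. u \<noteq> 0\<^sub>v n \<and> A *\<^sub>v u = \<alpha> \<cdot>\<^sub>v u \<and> B *\<^sub>v u = \<beta> \<cdot>\<^sub>v u"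
proof -
  obtain w \<alpha> where w: "w \<in> W" "w \<noteq> 0\<^sub>v n" "A *\<^sub>v w = \<alpha> \<cdot>\<^sub>v w"
    using invariant_subspace_has_eigenvector[OF A W invA v] by blast
  define E where "E = {x \<in> W. A *\<^sub>v x = \<alpha> \<cdot>\<^sub>v x}"
  have Wc: "x \<in> carrier_vec n" if "x \<in> W" for x
    using W that by (auto simp: subspace_of_def)
  have "subspace_of n E"
    unfolding subspace_of_def
  proof (intro conjI ballI allI)
    show "E \<subseteq> carrier_vec n" using Wc by (auto simp: E_def)
  next
    fix x y assume xy: "x \<in> E" "y \<in> E"
    then have x: "x \<in> carrier_vec n" and y: "y \<in> carrier_vec n" using Wc by (auto simp: E_def)
    have "A *\<^sub>v (x - y) = A *\<^sub>v x - A *\<^sub>v y" by (rule mult_minus_distrib_mat_vec[OF A x y])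
    also have "\<dots> = \<alpha> \<cdot>\<^sub>v (x - y)"
      using xy x y by (intro eq_vecI) (auto simp: E_def algebra_simps)
    finally show "x - y \<in> E" using xy W by (auto simp: E_def subspace_of_def)
  next
    fix c x assume "x \<in> E"
    with W A Wc show "c \<cdot>\<^sub>v x \<in> E"
      by (auto simp: E_def subspace_of_def mult_mat_vec smult_smult_assoc mult.commute)
  qed
  moreover have "B *\<^sub>v x \<in> E" if "x \<in> E" for x
  proof -
    have x: "x \<in> carrier_vec n" using that Wc by (auto simp: E_def)
    have "A *\<^sub>v (B *\<^sub>v x) = B *\<^sub>v (A *\<^sub>v x)"
      using A B x by (simp flip: assoc_mult_mat_vec add: AB)
    also have "\<dots> = \<alpha> \<cdot>\<^sub>v (B *\<^sub>v x)"
      using that B x by (simp add: E_def mult_mat_vec)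
    finally show ?thesis using that invB by (simp add: E_def)
  qed
  moreover have "w \<in> E" using w by (simp add: E_def)
  ultimately obtain u \<beta> where "u \<in> E" "u \<noteq> 0\<^sub>v n" "B *\<^sub>v u = \<beta> \<cdot>\<^sub>v u"
    using invariant_subspace_has_eigenvector[OF B] w(2) by meson
  then show ?thesis by (auto simp: E_def)
qed

section \<open>Orthonormal bases and spectral matrices\<close>

definition orthonormal_basis :: "nat \<Rightarrow> (nat \<Rightarrow> complex vec) \<Rightarrow> bool" where
  "orthonormal_basis n u \<longleftrightarrow> (\<forall>i<n. u i \<in> carrier_vec n) \<and>
     (\<forall>i<n. \<forall>j<n. u i \<bullet>c u j = (if i = j then 1 else 0))"

definition basis_mat :: "nat \<Rightarrow> (nat \<Rightarrow> complex vec) \<Rightarrow> complex mat" where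
  "basis_mat n u = mat n n (\<lambda>(r, i). u i $ r)"

definition spectral_mat :: "nat \<Rightarrow> (nat \<Rightarrow> complex vec) \<Rightarrow> (nat \<Rightarrow> real) \<Rightarrow> complex mat" where
  "spectral_mat n u x =
     basis_mat n u * mat_diag n (\<lambda>i. complex_of_real (x i)) * mat_adjoint (basis_mat n u)"

lemma basis_mat_carrier[simp]: "basis_mat n u \<in> carrier_mat n n"
  and dim_row_basis_mat[simp]: "dim_row (basis_mat n u) = n"
  and dim_col_basis_mat[simp]: "dim_col (basis_mat n u) = n"
  by (auto simp: basis_mat_def)

lemma index_basis_mat[simp]: "r < n \<Longrightarrow> i < n \<Longrightarrow> basis_mat n u $$ (r, i) = u i $ r"
  by (simp add: basis_mat_def)

lemma spectral_mat_carrier[simp]: "spectral_mat n u x \<in> carrier_mat n n"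
  by (simp add: spectral_mat_def mult_carrier_mat[of _ n n])

lemma dim_row_spectral_mat[simp]: "dim_row (spectral_mat n u x) = n"
  and dim_col_spectral_mat[simp]: "dim_col (spectral_mat n u x) = n"
  using spectral_mat_carrier by blast+

lemma orthonormal_basis_carrier: "orthonormal_basis n u \<Longrightarrow> i < n \<Longrightarrow> u i \<in> carrier_vec n"
  by (simp add: orthonormal_basis_def)

lemma adjoint_basis_mat_mult_basis_mat:
  assumes "orthonormal_basis n u"
  shows "mat_adjoint (basis_mat n u) * basis_mat n u = 1\<^sub>m n"
proof (rule eq_matI)
  fix i j assume "i < dim_row (1\<^sub>m n :: complex mat)" "j < dim_col (1\<^sub>m n :: complex mat)"
  then have ij: "i < n" "j < n" by auto
  then have "(mat_adjoint (basis_mat n u) * basis_mat n u) $$ (i, j) = (\<Sum>r<n. u j $ r * cnj (u i $ r))"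
    by (simp add: scalar_prod_def atLeast0LessThan mult.commute)
  also have "\<dots> = u j \<bullet>c u i"
    by (rule cscalar_prod_eq_sum[symmetric]) (use assms ij in \<open>auto simp: orthonormal_basis_def\<close>)
  finally show "(mat_adjoint (basis_mat n u) * basis_mat n u) $$ (i, j) = 1\<^sub>m n $$ (i, j)"
    using assms ij by (simp add: orthonormal_basis_def)
qed auto

lemma basis_mat_mult_adjoint_basis_mat:
  "orthonormal_basis n u \<Longrightarrow> basis_mat n u * mat_adjoint (basis_mat n u) = 1\<^sub>m n"
  by (rule mat_mult_left_right_inverse) (auto simp: adjoint_basis_mat_mult_basis_mat)

lemma index_spectral_mat:
  "r < n \<Longrightarrow> c < n \<Longrightarrow> spectral_mat n u x $$ (r, c) = (\<Sum>i<n. x i * (u i $ r * cnj (u i $ c)))"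
  by (simp add: spectral_mat_def mat_diag_mult_right[of _ n] scalar_prod_def atLeast0LessThan mult_ac)

lemma hermitian_spectral_mat: "hermitian_mat n (spectral_mat n u x)"
  unfolding hermitian_mat_def by (auto intro!: eq_matI simp: index_spectral_mat mult_ac)

lemma spectral_mat_add: "spectral_mat n u x + spectral_mat n u y = spectral_mat n u (\<lambda>i. x i + y i)"
  by (rule eq_matI) (auto simp: index_spectral_mat sum.distrib algebra_simps)

lemma spectral_mat_minus: "spectral_mat n u x - spectral_mat n u y = spectral_mat n u (\<lambda>i. x i - y i)"
  by (rule eq_matI) (auto simp: index_spectral_mat sum_subtractf algebra_simps)

lemma spectral_mat_cong: "(\<And>i. i < n \<Longrightarrow> x i = y i) \<Longrightarrow> spectral_mat n u x = spectral_mat n u y"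
  by (rule eq_matI) (auto simp: index_spectral_mat)

lemma spectral_mat_reindex:
  assumes "bij_betw \<pi> {..<n} {..<n}"
  shows "spectral_mat n (u \<circ> \<pi>) (x \<circ> \<pi>) = spectral_mat n u x"
proof (rule eq_matI)
  fix r c assume "r < dim_row (spectral_mat n u x)" "c < dim_col (spectral_mat n u x)"
  then show "spectral_mat n (u \<circ> \<pi>) (x \<circ> \<pi>) $$ (r, c) = spectral_mat n u x $$ (r, c)"
    using sum.reindex_bij_betw[OF assms, of "\<lambda>i. x i * (u i $ r * cnj (u i $ c))"]
    by (simp add: index_spectral_mat)
qed auto

lemma orthonormal_basis_reindex:
  assumes u: "orthonormal_basis n u" and \<pi>: "bij_betw \<pi> {..<n} {..<n}"
  shows "orthonormal_basis n (u \<circ> \<pi>)"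
proof -
  have "\<pi> i < n" if "i < n" for i using \<pi> that by (auto dest: bij_betw_apply)
  moreover have "\<pi> i = \<pi> j \<longleftrightarrow> i = j" if "i < n" "j < n" for i j
    using \<pi> that unfolding bij_betw_def inj_on_def by auto
  ultimately show ?thesis using u unfolding orthonormal_basis_def by auto
qed

lemma spectral_mat_mult:
  assumes u: "orthonormal_basis n u"
  shows "spectral_mat n u x * spectral_mat n u y = spectral_mat n u (\<lambda>i. x i * y i)"
proof -
  let ?B = "basis_mat n u" and ?D = "\<lambda>x. mat_diag n (\<lambda>i. complex_of_real (x i))"
  have "spectral_mat n u x * spectral_mat n u y = ?B * (?D x * (mat_adjoint ?B * ?B) * ?D y) * mat_adjoint ?B"
    unfolding spectral_mat_def by (simp add: assoc_mult_mat[of _ n n _ n _ n] mult_carrier_mat[of _ n n])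
  also have "\<dots> = ?B * ?D (\<lambda>i. x i * y i) * mat_adjoint ?B"
    using u by (simp add: adjoint_basis_mat_mult_basis_mat right_mult_one_mat[of _ n n])
  finally show ?thesis by (simp only: spectral_mat_def)
qed

lemma spectral_mat_commute:
  "orthonormal_basis n u \<Longrightarrow> spectral_mat n u x * spectral_mat n u y = spectral_mat n u y * spectral_mat n u x"
  by (simp add: spectral_mat_mult mult.commute)

lemma mat_diag_mult_vec:
  assumes "v \<in> carrier_vec n"
  shows "mat_diag n f *\<^sub>v v = vec n (\<lambda>i. f i * v $ i)"
proof (rule eq_vecI)
  fix i assume "i < dim_vec (vec n (\<lambda>i. f i * v $ i))"
  then have i: "i < n" by simp
  have "(mat_diag n f *\<^sub>v v) $ i = (\<Sum>k<n. (if k = i then f i * v $ k else 0))"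
    using i assms by (intro trans[OF mult_mat_vec_index_sum[of _ n n]] sum.cong) (auto simp: mat_diag_def)
  then show "(mat_diag n f *\<^sub>v v) $ i = vec n (\<lambda>i. f i * v $ i) $ i"
    using i by simp
qed (simp add: mat_diag_def)

lemma cscalar_prod_spectral_mat:
  assumes u: "orthonormal_basis n u" and w: "w \<in> carrier_vec n"
  shows "(spectral_mat n u x *\<^sub>v w) \<bullet>c w = of_real (\<Sum>i<n. x i * (cmod (w \<bullet>c u i))\<^sup>2)"
proof -
  let ?B = "basis_mat n u" and ?D = "mat_diag n (\<lambda>i. complex_of_real (x i))"
  let ?b = "mat_adjoint ?B *\<^sub>v w"
  have b: "?b \<in> carrier_vec n"
    using mat_adjoint_carrier[OF basis_mat_carrier] w by (rule mult_mat_vec_carrier)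
  have b_index: "?b $ i = w \<bullet>c u i" if "i < n" for i
    using that w orthonormal_basis_carrier[OF u that]
    by (simp add: cscalar_prod_eq_sum scalar_prod_def atLeast0LessThan mult.commute)
  have "spectral_mat n u x *\<^sub>v w = ?B *\<^sub>v (?D *\<^sub>v ?b)"
    using w b by (simp add: spectral_mat_def assoc_mult_mat_vec[of _ n n _ n] mult_carrier_mat[of _ n n])
  then have "(spectral_mat n u x *\<^sub>v w) \<bullet>c w = (?D *\<^sub>v ?b) \<bullet>c ?b"
    using cscalar_prod_mat_adjoint[OF basis_mat_carrier mult_mat_vec_carrier[OF mat_diag_dim b] w] by simp
  also have "\<dots> = (\<Sum>i<n. x i * (?b $ i * cnj (?b $ i)))"
    using b by (simp add: mat_diag_mult_vec cscalar_prod_eq_sum[of _ n] mult.assoc)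
  also have "\<dots> = (\<Sum>i<n. of_real (x i * (cmod (w \<bullet>c u i))\<^sup>2))"
  proof (rule sum.cong)
    fix i assume "i \<in> {..<n}"
    then show "x i * (?b $ i * cnj (?b $ i)) = of_real (x i * (cmod (w \<bullet>c u i))\<^sup>2)"
      by (simp only: lessThan_iff b_index complex_norm_square of_real_mult)
  qed simp
  also have "\<dots> = of_real (\<Sum>i<n. x i * (cmod (w \<bullet>c u i))\<^sup>2)"
    by simp
  finally show ?thesis .
qed

lemma Re_cscalar_prod_spectral_mat_combination:
  assumes "orthonormal_basis n u" "w \<in> carrier_vec n"
  shows "Re ((spectral_mat n u (\<lambda>i. x i + K * s i) *\<^sub>v w) \<bullet>c w)
    = Re ((spectral_mat n u x *\<^sub>v w) \<bullet>c w) + K * Re ((spectral_mat n u s *\<^sub>v w) \<bullet>c w)"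
  by (simp add: cscalar_prod_spectral_mat[OF assms] sum.distrib sum_distrib_left algebra_simps)

lemma psd_spectral_mat:
  "orthonormal_basis n u \<Longrightarrow> (\<And>i. i < n \<Longrightarrow> 0 \<le> x i) \<Longrightarrow> psd_mat n (spectral_mat n u x)"
  unfolding psd_mat_def by (auto simp: hermitian_spectral_mat cscalar_prod_spectral_mat intro!: sum_nonneg)

lemma spectral_mat_one: "orthonormal_basis n u \<Longrightarrow> spectral_mat n u (\<lambda>_. 1) = 1\<^sub>m n"
  by (simp add: spectral_mat_def basis_mat_mult_adjoint_basis_mat)

lemma orthonormal_basis_parseval:
  assumes "orthonormal_basis n u" "w \<in> carrier_vec n"
  shows "Re (w \<bullet>c w) = (\<Sum>i<n. (cmod (w \<bullet>c u i))\<^sup>2)"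
  using cscalar_prod_spectral_mat[OF assms, of "\<lambda>_. 1"] assms by (simp add: spectral_mat_one)

lemma mat_trace_add:
  "A \<in> carrier_mat n n \<Longrightarrow> B \<in> carrier_mat n n \<Longrightarrow> mat_trace (A + B) = mat_trace A + mat_trace B"
  by (simp add: mat_trace_def sum.distrib)

lemma mat_trace_minus:
  "A \<in> carrier_mat n n \<Longrightarrow> B \<in> carrier_mat n n \<Longrightarrow> mat_trace (A - B) = mat_trace A - mat_trace B"
  by (simp add: mat_trace_def sum_subtractf)

lemma mat_trace_spectral_mat:
  assumes u: "orthonormal_basis n u"
  shows "mat_trace (spectral_mat n u x) = of_real (\<Sum>i<n. x i)"
proof -
  have "mat_trace (spectral_mat n u x) = (\<Sum>r<n. \<Sum>i<n. x i * (u i $ r * cnj (u i $ r)))"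
    by (simp add: mat_trace_def index_spectral_mat)
  also have "\<dots> = (\<Sum>i<n. x i * (\<Sum>r<n. u i $ r * cnj (u i $ r)))"
    by (subst sum.swap) (simp add: sum_distrib_left)
  also have "\<dots> = of_real (\<Sum>i<n. x i)"
  proof -
    have "(\<Sum>r<n. u i $ r * cnj (u i $ r)) = u i \<bullet>c u i" if "i < n" for i
      using cscalar_prod_eq_sum[of "u i" n "u i"] u that by (simp add: orthonormal_basis_def)
    then show ?thesis
      using u by (simp add: orthonormal_basis_def)
  qed
  finally show ?thesis .
qed

lemma proots_char_poly_spectral_mat:
  assumes u: "orthonormal_basis n u"
  shows "proots (char_poly (spectral_mat n u x)) = image_mset (\<lambda>i. complex_of_real (x i)) (mset_set {..<n})"
proof -
  let ?B = "basis_mat n u" and ?D = "mat_diag n (\<lambda>i. complex_of_real (x i))"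
  have "similar_mat (spectral_mat n u x) ?D"
    unfolding similar_mat_def similar_mat_wit_def spectral_mat_def Let_def
    using u by (intro exI[of _ ?B] exI[of _ "mat_adjoint ?B"])
      (auto simp: adjoint_basis_mat_mult_basis_mat basis_mat_mult_adjoint_basis_mat mult_carrier_mat[of _ n n])
  then have "char_poly (spectral_mat n u x) = char_poly ?D"
    by (rule char_poly_similar)
  also have "\<dots> = (\<Prod>a\<leftarrow>diag_mat ?D. [:- a, 1:])"
    by (rule char_poly_upper_triangular[of _ n]) (auto simp: upper_triangular_def mat_diag_def)
  also have "diag_mat ?D = map (\<lambda>i. complex_of_real (x i)) [0..<n]"
    by (auto simp: diag_mat_def mat_diag_def intro!: map_cong)
  finally have char: "char_poly (spectral_mat n u x) = (\<Prod>i\<leftarrow>[0..<n]. [:- complex_of_real (x i), 1:])"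
    by (simp add: o_def)
  have "0 \<notin> set (map (\<lambda>i. [:- complex_of_real (x i), 1:]) [0..<n])"
    by auto
  from proots_prod_list[OF this]
  have "proots (\<Prod>i\<leftarrow>[0..<n]. [:- complex_of_real (x i), 1:]) = (\<Sum>i\<leftarrow>[0..<n]. {#complex_of_real (x i)#})"
    by (simp add: o_def)
  then show ?thesis
    unfolding char by (simp add: sum_list_singleton_mset mset_set_upto_eq_mset_upto)
qed

lemma trace_norm_spectral_mat:
  assumes u: "orthonormal_basis n u"
  shows "trace_norm (spectral_mat n u x) = (\<Sum>i<n. \<bar>x i\<bar>)"
proof -
  have "mat_adjoint (spectral_mat n u x) * spectral_mat n u x = spectral_mat n u (\<lambda>i. x i * x i)"
    using hermitian_spectral_mat[of n u x] spectral_mat_mult[OF u] by (simp add: hermitian_mat_def)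
  then have "trace_norm (spectral_mat n u x) = (\<Sum>i<n. sqrt (x i * x i))"
    by (simp add: trace_norm_def proots_char_poly_spectral_mat[OF u] sum_unfold_sum_mset
        image_mset.compositionality o_def flip: of_real_mult)
  then show ?thesis by simp
qed

lemma spectral_mat_eigenbasis:
  assumes A: "A \<in> carrier_mat n n" and u: "orthonormal_basis n u"
    and eig: "\<And>i. i < n \<Longrightarrow> A *\<^sub>v u i = complex_of_real (x i) \<cdot>\<^sub>v u i"
  shows "A = spectral_mat n u x"
proof -
  let ?B = "basis_mat n u" and ?D = "mat_diag n (\<lambda>i. complex_of_real (x i))"
  have AB: "A * ?B = ?B * ?D"
  proof (rule eq_matI)
    fix r i assume "r < dim_row (?B * ?D)" "i < dim_col (?B * ?D)"
    then have ri: "r < n" "i < n" by (auto simp: mat_diag_def)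
    have "(A * ?B) $$ (r, i) = (A *\<^sub>v u i) $ r"
      using A ri orthonormal_basis_carrier[OF u ri(2)] by (simp add: scalar_prod_def)
    then show "(A * ?B) $$ (r, i) = (?B * ?D) $$ (r, i)"
      using ri eig[OF ri(2)] orthonormal_basis_carrier[OF u ri(2)] by (simp add: mat_diag_mult_right[of _ n])
  qed (use A in \<open>auto simp: mat_diag_def\<close>)
  have "A = A * (?B * mat_adjoint ?B)"
    using A u by (simp add: basis_mat_mult_adjoint_basis_mat)
  also have "\<dots> = ?B * ?D * mat_adjoint ?B"
    using A by (simp flip: assoc_mult_mat[of _ n n _ n _ n] add: AB)
  finally show ?thesis unfolding spectral_mat_def .
qed

lemma mat_adjoint_basis_change:
  "mat_adjoint (basis_mat n u * mat_adjoint (basis_mat n v)) = basis_mat n v * mat_adjoint (basis_mat n u)"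
  using mat_adjoint_mult[of "basis_mat n u" n n "mat_adjoint (basis_mat n v)" n] by simp

lemma unitary_basis_change:
  assumes u: "orthonormal_basis n u" and v: "orthonormal_basis n v"
  shows "unitary_mat n (basis_mat n u * mat_adjoint (basis_mat n v))"
proof -
  let ?U = "basis_mat n u" and ?V = "basis_mat n v"
  have "?U * mat_adjoint ?V * (?V * mat_adjoint ?U) = ?U * (mat_adjoint ?V * ?V) * mat_adjoint ?U"
    and "?V * mat_adjoint ?U * (?U * mat_adjoint ?V) = ?V * (mat_adjoint ?U * ?U) * mat_adjoint ?V"
    by (simp_all add: assoc_mult_mat[of _ n n _ n _ n] mult_carrier_mat[of _ n n])
  then show ?thesis
    unfolding unitary_mat_def mat_adjoint_basis_change using u v
    by (simp add: adjoint_basis_mat_mult_basis_mat basis_mat_mult_adjoint_basis_mat mult_carrier_mat[of _ n n])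
qed

lemma unitary_channel_basis_change:
  assumes u: "orthonormal_basis n u" and v: "orthonormal_basis n v"
  shows "unitary_channel (basis_mat n u * mat_adjoint (basis_mat n v)) (spectral_mat n v x) = spectral_mat n u x"
proof -
  let ?U = "basis_mat n u" and ?V = "basis_mat n v" and ?D = "mat_diag n (\<lambda>i. complex_of_real (x i))"
  have "unitary_channel (?U * mat_adjoint ?V) (spectral_mat n v x)
      = ?U * (mat_adjoint ?V * ?V) * ?D * (mat_adjoint ?V * ?V) * mat_adjoint ?U"
    by (simp add: unitary_channel_def spectral_mat_def mat_adjoint_basis_change
        assoc_mult_mat[of _ n n _ n _ n] mult_carrier_mat[of _ n n])
  then show ?thesis
    using v by (simp add: adjoint_basis_mat_mult_basis_mat spectral_mat_def
        right_mult_one_mat[of _ n n] mult_carrier_mat[of _ n n])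
qed

section \<open>Joint eigenbases of commuting Hermitian matrices\<close>

lemma orthogonal_complement_subspace:
  fixes u :: "nat \<Rightarrow> complex vec"
  assumes "\<And>i. i < k \<Longrightarrow> u i \<in> carrier_vec n"
  shows "subspace_of n {x \<in> carrier_vec n. \<forall>i<k. x \<bullet>c u i = 0}"
proof -
  have "(x - y) \<bullet>c u i = x \<bullet>c u i - y \<bullet>c u i" "(c \<cdot>\<^sub>v x) \<bullet>c u i = c * (x \<bullet>c u i)"
    if "x \<in> carrier_vec n" "y \<in> carrier_vec n" "i < k" for x y c i
    using cscalar_prod_minus_left[OF that(1,2) assms[OF that(3)]] cscalar_prod_smult_left[OF that(1) assms[OF that(3)]]
    by simp_all
  then show ?thesis by (auto simp: subspace_of_def)
qed

lemma hermitian_orthogonal_complement_invariant: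
  assumes H: "hermitian_mat n H" and u: "\<And>i. i < k \<Longrightarrow> u i \<in> carrier_vec n"
    and eig: "\<And>i. i < k \<Longrightarrow> H *\<^sub>v u i = \<gamma> i \<cdot>\<^sub>v u i"
    and "x \<in> {x \<in> carrier_vec n. \<forall>i<k. x \<bullet>c u i = 0}"
  shows "H *\<^sub>v x \<in> {x \<in> carrier_vec n. \<forall>i<k. x \<bullet>c u i = 0}"
proof -
  have x: "x \<in> carrier_vec n" "\<forall>i<k. x \<bullet>c u i = 0" using assms(4) by simp_all
  have "(H *\<^sub>v x) \<bullet>c u i = 0" if i: "i < k" for i
  proof -
    have "(H *\<^sub>v x) \<bullet>c u i = x \<bullet>c (\<gamma> i \<cdot>\<^sub>v u i)"
      using hermitian_cscalar_prod[OF H x(1) u[OF i]] eig[OF i] by simp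
    then show ?thesis
      using x u[OF i] i by (simp add: cscalar_prod_smult_right[of x n])
  qed
  moreover have "H *\<^sub>v x \<in> carrier_vec n"
    using hermitian_mat_carrier[OF H] x(1) by simp
  ultimately show ?thesis by simp
qed

lemma exists_normalizing_scalar:
  assumes w: "w \<in> carrier_vec n" "w \<noteq> 0\<^sub>v n"
  shows "\<exists>c. (c \<cdot>\<^sub>v w) \<bullet>c (c \<cdot>\<^sub>v w) = (1 :: complex)"
proof -
  define s where "s = Re (w \<bullet>c w)"
  have ws: "w \<bullet>c w = of_real s"
    using cscalar_prod_self[OF w(1)] by (simp add: s_def)
  have "s > 0" using cscalar_prod_self_pos[OF w] by (simp add: s_def)
  then have "(complex_of_real (1 / sqrt s) \<cdot>\<^sub>v w) \<bullet>c (complex_of_real (1 / sqrt s) \<cdot>\<^sub>v w) = 1"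
    using w(1) by (simp add: ws cscalar_prod_smult_left cscalar_prod_smult_right flip: of_real_mult)
  then show ?thesis by blast
qed

lemma joint_eigenvector_orthogonal:
  assumes HA: "hermitian_mat n A" and HB: "hermitian_mat n B" and AB: "A * B = B * A"
    and k: "k < n" and u: "\<And>i. i < k \<Longrightarrow> u i \<in> carrier_vec n"
    and eigA: "\<And>i. i < k \<Longrightarrow> A *\<^sub>v u i = \<alpha> i \<cdot>\<^sub>v u i"
    and eigB: "\<And>i. i < k \<Longrightarrow> B *\<^sub>v u i = \<beta> i \<cdot>\<^sub>v u i"
  shows "\<exists>x\<in>carrier_vec n. \<exists>\<mu> \<nu>. x \<bullet>c x = 1 \<and> (\<forall>i<k. x \<bullet>c u i = 0) \<and>
    A *\<^sub>v x = \<mu> \<cdot>\<^sub>v x \<and> B *\<^sub>v x = \<nu> \<cdot>\<^sub>v x"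
proof -
  let ?W = "{x \<in> carrier_vec n. \<forall>i<k. x \<bullet>c u i = 0}"
  obtain y where "y \<in> ?W" "y \<noteq> 0\<^sub>v n"
    using exists_nonzero_orthogonal_vec[of k n u] k u by auto
  then obtain w \<mu> \<nu> where w: "w \<in> ?W" "w \<noteq> 0\<^sub>v n" and eig: "A *\<^sub>v w = \<mu> \<cdot>\<^sub>v w" "B *\<^sub>v w = \<nu> \<cdot>\<^sub>v w"
    using invariant_subspace_has_common_eigenvector[OF hermitian_mat_carrier[OF HA] hermitian_mat_carrier[OF HB] AB
        orthogonal_complement_subspace[where u = u, OF u]
        hermitian_orthogonal_complement_invariant[where u = u and \<gamma> = \<alpha>, OF HA u eigA]
        hermitian_orthogonal_complement_invariant[where u = u and \<gamma> = \<beta>, OF HB u eigB]]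
    by blast
  have wc: "w \<in> carrier_vec n" using w(1) by simp
  obtain c where unit: "(c \<cdot>\<^sub>v w) \<bullet>c (c \<cdot>\<^sub>v w) = 1"
    using exists_normalizing_scalar[OF wc w(2)] by blast
  have "\<forall>i<k. (c \<cdot>\<^sub>v w) \<bullet>c u i = 0"
    using w(1) u by (auto simp: cscalar_prod_smult_left[of w n])
  moreover have "A *\<^sub>v (c \<cdot>\<^sub>v w) = \<mu> \<cdot>\<^sub>v (c \<cdot>\<^sub>v w)" "B *\<^sub>v (c \<cdot>\<^sub>v w) = \<nu> \<cdot>\<^sub>v (c \<cdot>\<^sub>v w)"
    using mult_mat_vec[OF hermitian_mat_carrier[OF HA] wc] mult_mat_vec[OF hermitian_mat_carrier[OF HB] wc] eig
    by (simp_all add: smult_smult_assoc mult.commute)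
  moreover have "c \<cdot>\<^sub>v w \<in> carrier_vec n" using wc by simp
  ultimately show ?thesis using unit by blast
qed

lemma orthonormal_joint_eigenvectors:
  assumes HA: "hermitian_mat n A" and HB: "hermitian_mat n B" and AB: "A * B = B * A"
    and "k \<le> n"
  shows "\<exists>u \<alpha> \<beta>. (\<forall>i<k. u i \<in> carrier_vec n) \<and> (\<forall>i<k. \<forall>j<k. u i \<bullet>c u j = (if i = j then 1 else 0)) \<and>
    (\<forall>i<k. A *\<^sub>v u i = \<alpha> i \<cdot>\<^sub>v u i \<and> B *\<^sub>v u i = \<beta> i \<cdot>\<^sub>v u i)"
  using \<open>k \<le> n\<close>
proof (induction k)
  case 0
  then show ?case by simp
next
  case (Suc k)
  then obtain u \<alpha> \<beta> where u: "\<forall>i<k. u i \<in> carrier_vec n"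
    and orth: "\<forall>i<k. \<forall>j<k. u i \<bullet>c u j = (if i = j then 1 else 0)"
    and eig: "\<forall>i<k. A *\<^sub>v u i = \<alpha> i \<cdot>\<^sub>v u i \<and> B *\<^sub>v u i = \<beta> i \<cdot>\<^sub>v u i"
    by auto
  obtain x \<mu> \<nu> where x: "x \<in> carrier_vec n" "x \<bullet>c x = 1" "\<forall>i<k. x \<bullet>c u i = 0"
    and eig_x: "A *\<^sub>v x = \<mu> \<cdot>\<^sub>v x" "B *\<^sub>v x = \<nu> \<cdot>\<^sub>v x"
    using joint_eigenvector_orthogonal[OF HA HB AB, of k u \<alpha> \<beta>] Suc.prems u eig by auto
  have "u i \<bullet>c x = 0" if "i < k" for i
    using cscalar_prod_swap[of "u i" n x] u x that by simp
  with u orth eig x eig_x show ?case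
    by (intro exI[of _ "u(k := x)"] exI[of _ "\<alpha>(k := \<mu>)"] exI[of _ "\<beta>(k := \<nu>)"]) (auto simp: less_Suc_eq)
qed

lemma hermitian_eigenvalue_real:
  assumes H: "hermitian_mat n H" and u: "u \<in> carrier_vec n" "u \<bullet>c u = 1" and eig: "H *\<^sub>v u = \<alpha> \<cdot>\<^sub>v u"
  shows "complex_of_real (Re \<alpha>) = \<alpha>"
proof -
  have "\<alpha> * (u \<bullet>c u) = cnj \<alpha> * (u \<bullet>c u)"
    using hermitian_cscalar_prod[OF H u(1) u(1)] u(1)
    by (simp add: eig cscalar_prod_smult_left[of _ n] cscalar_prod_smult_right[of _ n])
  then have "\<alpha> = cnj \<alpha>" using u(2) by simp
  then show ?thesis by (metis Reals_cnj_iff complex_is_Real_iff of_real_Re)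
qed

lemma commuting_hermitian_joint_eigenbasis:
  assumes HA: "hermitian_mat n A" and HB: "hermitian_mat n B" and AB: "A * B = B * A"
  shows "\<exists>u a b. orthonormal_basis n u \<and> A = spectral_mat n u a \<and> B = spectral_mat n u b"
proof -
  obtain u \<alpha> \<beta> where u: "orthonormal_basis n u"
    and eig: "\<And>i. i < n \<Longrightarrow> A *\<^sub>v u i = \<alpha> i \<cdot>\<^sub>v u i \<and> B *\<^sub>v u i = \<beta> i \<cdot>\<^sub>v u i"
    using orthonormal_joint_eigenvectors[OF HA HB AB order.refl] unfolding orthonormal_basis_def by blast
  have "A *\<^sub>v u i = complex_of_real (Re (\<alpha> i)) \<cdot>\<^sub>v u i" "B *\<^sub>v u i = complex_of_real (Re (\<beta> i)) \<cdot>\<^sub>v u i"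
    if "i < n" for i
    using hermitian_eigenvalue_real[OF HA, of "u i" "\<alpha> i"] hermitian_eigenvalue_real[OF HB, of "u i" "\<beta> i"]
      eig[OF that] u that by (auto simp: orthonormal_basis_def)
  then have "A = spectral_mat n u (\<lambda>i. Re (\<alpha> i))" "B = spectral_mat n u (\<lambda>i. Re (\<beta> i))"
    using HA HB u by (auto intro!: spectral_mat_eigenbasis simp: hermitian_mat_carrier)
  with u show ?thesis by blast
qed

lemma exists_sorting_bij:
  fixes key :: "nat \<Rightarrow> 'a :: linorder"
  shows "\<exists>\<pi>. bij_betw \<pi> {..<n} {..<n} \<and> antimono_on {..<n} (key \<circ> \<pi>)"
proof -
  define xs where "xs = map key [0..<n]"
  define ys where "ys = rev (sort xs)"
  have len: "length xs = n" "length ys = n" by (simp_all add: xs_def ys_def)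
  have "mset ys = mset xs" by (simp add: ys_def)
  from permutation_Ex_bij[OF this] obtain \<pi> where \<pi>: "bij_betw \<pi> {..<n} {..<n}"
    and nth: "\<And>i. i < n \<Longrightarrow> ys ! i = xs ! \<pi> i"
    using len by auto
  have key: "key (\<pi> i) = ys ! i" if "i < n" for i
    using nth[OF that] bij_betw_apply[OF \<pi>] that by (simp add: xs_def)
  have "key (\<pi> j) \<le> key (\<pi> i)" if "i \<le> j" "j < n" for i j
  proof -
    have "sort xs ! (n - Suc j) \<le> sort xs ! (n - Suc i)"
      by (rule sorted_nth_mono) (use that len in auto)
    then show ?thesis
      using that len by (simp add: key ys_def rev_nth)
  qed
  then have "antimono_on {..<n} (key \<circ> \<pi>)"
    by (auto simp: monotone_on_def)
  with \<pi> show ?thesis by blast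
qed

(* For large K, ordering by x + K s sorts by the eigenvalue of S first and by that of X second. *)
definition sorted_joint_eigenbasis ::
  "nat \<Rightarrow> real \<Rightarrow> complex mat \<Rightarrow> complex mat \<Rightarrow> (nat \<Rightarrow> complex vec) \<Rightarrow> (nat \<Rightarrow> real) \<Rightarrow> (nat \<Rightarrow> real) \<Rightarrow> bool"
where
  "sorted_joint_eigenbasis n K X S u x s \<longleftrightarrow>
     orthonormal_basis n u \<and> X = spectral_mat n u x \<and> S = spectral_mat n u s \<and>
     antimono_on {..<n} (\<lambda>i. x i + K * s i)"

lemma sorted_joint_eigenbasis_exists:
  assumes "hermitian_mat n X" "hermitian_mat n S" "X * S = S * X"
  shows "\<exists>u x s. sorted_joint_eigenbasis n K X S u x s"
proof -
  obtain u x s where u: "orthonormal_basis n u" and XS: "X = spectral_mat n u x" "S = spectral_mat n u s"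
    using commuting_hermitian_joint_eigenbasis[OF assms] by blast
  obtain \<pi> where \<pi>: "bij_betw \<pi> {..<n} {..<n}" and sorted: "antimono_on {..<n} ((\<lambda>i. x i + K * s i) \<circ> \<pi>)"
    using exists_sorting_bij by blast
  have "sorted_joint_eigenbasis n K X S (u \<circ> \<pi>) (x \<circ> \<pi>) (s \<circ> \<pi>)"
    unfolding sorted_joint_eigenbasis_def
    using orthonormal_basis_reindex[OF u \<pi>] spectral_mat_reindex[OF \<pi>] XS sorted by (simp add: o_def)
  then show ?thesis by blast
qed

section \<open>Weyl monotonicity\<close>

definition loewner_le :: "nat \<Rightarrow> complex mat \<Rightarrow> complex mat \<Rightarrow> bool" where
  "loewner_le n X Y \<longleftrightarrow> (\<forall>w\<in>carrier_vec n. Re ((X *\<^sub>v w) \<bullet>c w) \<le> Re ((Y *\<^sub>v w) \<bullet>c w))"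

lemma loewner_le_add_psd:
  assumes X: "X \<in> carrier_mat n n" and P: "psd_mat n P"
  shows "loewner_le n X (X + P)"
  unfolding loewner_le_def
proof
  fix w :: "complex vec" assume w: "w \<in> carrier_vec n"
  have Pc: "P \<in> carrier_mat n n" using P by (simp add: psd_mat_def hermitian_mat_def)
  have "((X + P) *\<^sub>v w) \<bullet>c w = (X *\<^sub>v w) \<bullet>c w + (P *\<^sub>v w) \<bullet>c w"
    using X Pc w by (simp add: add_mult_distrib_mat_vec add_scalar_prod_distrib[of _ n])
  then show "Re ((X *\<^sub>v w) \<bullet>c w) \<le> Re (((X + P) *\<^sub>v w) \<bullet>c w)"
    using P w by (simp add: psd_mat_def)
qed

lemma cscalar_prod_basis_mat_mult_vec:
  assumes u: "orthonormal_basis n u" and a: "a \<in> carrier_vec n" and z: "z \<in> carrier_vec n"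
  shows "(basis_mat n u *\<^sub>v a) \<bullet>c z = (\<Sum>j<n. a $ j * (u j \<bullet>c z))"
proof -
  have "(basis_mat n u *\<^sub>v a) \<bullet>c z = (\<Sum>r<n. \<Sum>j<n. a $ j * (u j $ r * cnj (z $ r)))"
    using a z by (simp add: cscalar_prod_eq_sum[of _ n] scalar_prod_def atLeast0LessThan
        sum_distrib_left sum_distrib_right mult_ac)
  also have "\<dots> = (\<Sum>j<n. a $ j * (u j \<bullet>c z))"
  proof -
    have "(\<Sum>r<n. a $ j * (u j $ r * cnj (z $ r))) = a $ j * (u j \<bullet>c z)" if "j < n" for j
      using cscalar_prod_eq_sum[OF orthonormal_basis_carrier[OF u that] z] by (simp add: sum_distrib_left)
    then show ?thesis by (subst sum.swap) simp
  qed
  finally show ?thesis .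
qed

lemma exists_vec_in_span_orthogonal:
  assumes u: "orthonormal_basis n u" and k: "k < n" and y: "\<And>r. r < k \<Longrightarrow> y r \<in> carrier_vec n"
  shows "\<exists>w\<in>carrier_vec n. w \<noteq> 0\<^sub>v n \<and> (\<forall>i. k < i \<and> i < n \<longrightarrow> w \<bullet>c u i = 0) \<and> (\<forall>r<k. w \<bullet>c y r = 0)"
proof -
  obtain \<alpha> where \<alpha>: "\<alpha> \<in> carrier_vec (Suc k)" "\<alpha> \<noteq> 0\<^sub>v (Suc k)"
    and orth: "\<forall>r<k. \<alpha> \<bullet>c vec (Suc k) (\<lambda>j. y r \<bullet>c u j) = 0"
    using exists_nonzero_orthogonal_vec[of k "Suc k" "\<lambda>r. vec (Suc k) (\<lambda>j. y r \<bullet>c u j)"] by auto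
  define a where "a = vec n (\<lambda>j. if j \<le> k then \<alpha> $ j else 0)"
  define w where "w = basis_mat n u *\<^sub>v a"
  have a: "a \<in> carrier_vec n" by (simp add: a_def)
  have w: "w \<in> carrier_vec n" by (simp add: w_def carrier_vecI)
  have coord: "w \<bullet>c u i = a $ i" if "i < n" for i
  proof -
    have "w \<bullet>c u i = (\<Sum>j<n. if j = i then a $ j else 0)"
      unfolding w_def cscalar_prod_basis_mat_mult_vec[OF u a orthonormal_basis_carrier[OF u that]]
      using u that by (intro sum.cong) (auto simp: orthonormal_basis_def)
    then show ?thesis using that by simp
  qed
  have "w \<bullet>c y r = 0" if r: "r < k" for r
  proof -
    have "w \<bullet>c y r = (\<Sum>j<n. a $ j * (u j \<bullet>c y r))"
      unfolding w_def using cscalar_prod_basis_mat_mult_vec[OF u a y[OF r]] .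
    also have "\<dots> = (\<Sum>j<Suc k. \<alpha> $ j * (u j \<bullet>c y r))"
      using k by (intro sum.mono_neutral_cong_right) (auto simp: a_def)
    also have "\<dots> = \<alpha> \<bullet>c vec (Suc k) (\<lambda>j. y r \<bullet>c u j)"
    proof -
      have "u j \<bullet>c y r = cnj (y r \<bullet>c u j)" if "j < Suc k" for j
        using cscalar_prod_swap[OF orthonormal_basis_carrier[OF u] y[OF r]] that k by simp
      then show ?thesis
        using \<alpha>(1) by (simp add: cscalar_prod_eq_sum[of _ "Suc k"])
    qed
    finally show ?thesis using orth r by simp
  qed
  moreover obtain j where "j \<le> k" "\<alpha> $ j \<noteq> 0"
    using \<alpha> by (metis eq_vecI index_zero_vec(1,2) carrier_vecD less_Suc_eq_le)
  then have "w \<noteq> 0\<^sub>v n"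
    using coord[of j] k orthonormal_basis_carrier[OF u, of j] by (auto simp: a_def)
  moreover have "w \<bullet>c u i = 0" if "k < i" "i < n" for i
    using coord that by (simp add: a_def)
  ultimately show ?thesis using w by blast
qed

theorem weyl_monotonicity:
  assumes u: "orthonormal_basis n u" and v: "orthonormal_basis n v"
    and x: "antimono_on {..<n} x" and z: "antimono_on {..<n} z"
    and le: "loewner_le n (spectral_mat n u x) (spectral_mat n v z)" and k: "k < n"
  shows "x k \<le> z k"
proof -
  obtain w where w: "w \<in> carrier_vec n" "w \<noteq> 0\<^sub>v n"
    and above_k: "\<And>i. k < i \<Longrightarrow> i < n \<Longrightarrow> w \<bullet>c u i = 0" and below_k: "\<And>r. r < k \<Longrightarrow> w \<bullet>c v r = 0"
    using exists_vec_in_span_orthogonal[OF u k, of v] orthonormal_basis_carrier[OF v] k by auto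
  define S where "S = Re (w \<bullet>c w)"
  have S_pos: "S > 0" using cscalar_prod_self_pos[OF w] by (simp add: S_def)
  have "x k * S = (\<Sum>i<n. x k * (cmod (w \<bullet>c u i))\<^sup>2)"
    by (simp add: S_def orthonormal_basis_parseval[OF u w(1)] sum_distrib_left)
  also have "\<dots> \<le> (\<Sum>i<n. x i * (cmod (w \<bullet>c u i))\<^sup>2)"
  proof (rule sum_mono)
    fix i assume "i \<in> {..<n}"
    then show "x k * (cmod (w \<bullet>c u i))\<^sup>2 \<le> x i * (cmod (w \<bullet>c u i))\<^sup>2"
      using x k above_k[of i] by (cases "i \<le> k") (auto simp: monotone_on_def intro: mult_right_mono)
  qed
  also have "\<dots> \<le> (\<Sum>i<n. z i * (cmod (w \<bullet>c v i))\<^sup>2)"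
    using le w(1) by (simp add: loewner_le_def cscalar_prod_spectral_mat[OF u] cscalar_prod_spectral_mat[OF v])
  also have "\<dots> \<le> (\<Sum>i<n. z k * (cmod (w \<bullet>c v i))\<^sup>2)"
  proof (rule sum_mono)
    fix i assume "i \<in> {..<n}"
    then show "z i * (cmod (w \<bullet>c v i))\<^sup>2 \<le> z k * (cmod (w \<bullet>c v i))\<^sup>2"
      using z k below_k[of i] by (cases "k \<le> i") (auto simp: monotone_on_def intro: mult_right_mono)
  qed
  also have "\<dots> = z k * S"
    by (simp add: S_def orthonormal_basis_parseval[OF v w(1)] sum_distrib_left)
  finally show ?thesis using S_pos by simp
qed

section \<open>Matching sorted spectra\<close>

lemma sorted_joint_eigenbasis_weyl:
  assumes U: "sorted_joint_eigenbasis n K X S u x s" and V: "sorted_joint_eigenbasis n K Y S v y t"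
    and le: "loewner_le n X Y" and i: "i < n"
  shows "x i + K * s i \<le> y i + K * t i"
proof -
  from U have u: "orthonormal_basis n u" and X: "X = spectral_mat n u x" and Su: "S = spectral_mat n u s"
    and sorted_u: "antimono_on {..<n} (\<lambda>i. x i + K * s i)"
    by (simp_all add: sorted_joint_eigenbasis_def)
  from V have v: "orthonormal_basis n v" and Y: "Y = spectral_mat n v y" and Sv: "S = spectral_mat n v t"
    and sorted_v: "antimono_on {..<n} (\<lambda>i. y i + K * t i)"
    by (simp_all add: sorted_joint_eigenbasis_def)
  show ?thesis
  proof (rule weyl_monotonicity[OF u v sorted_u sorted_v _ i])
    show "loewner_le n (spectral_mat n u (\<lambda>i. x i + K * s i)) (spectral_mat n v (\<lambda>i. y i + K * t i))"
      unfolding loewner_le_def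
    proof
      fix w :: "complex vec" assume w: "w \<in> carrier_vec n"
      then have "Re ((X *\<^sub>v w) \<bullet>c w) \<le> Re ((Y *\<^sub>v w) \<bullet>c w)"
        using le by (simp add: loewner_le_def)
      then show "Re ((spectral_mat n u (\<lambda>i. x i + K * s i) *\<^sub>v w) \<bullet>c w)
          \<le> Re ((spectral_mat n v (\<lambda>i. y i + K * t i) *\<^sub>v w) \<bullet>c w)"
        unfolding Re_cscalar_prod_spectral_mat_combination[OF u w] Re_cscalar_prod_spectral_mat_combination[OF v w]
          X[symmetric] Y[symmetric] Su[symmetric] Sv[symmetric]
        by simp
    qed
  qed
qed

lemma sorted_spectra_dominated:
  assumes U: "sorted_joint_eigenbasis n K X S u x s" and V: "sorted_joint_eigenbasis n K Y S v y t"
    and le: "loewner_le n X Y"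
    and gap: "\<And>a b. a \<in># proots (char_poly S) \<Longrightarrow> b \<in># proots (char_poly S) \<Longrightarrow> a \<noteq> b \<Longrightarrow>
      trace_norm X + trace_norm Y < K * cmod (a - b)"
    and k: "k < n"
  shows "s k = t k" "x k \<le> y k"
proof -
  from U have u: "orthonormal_basis n u" and X: "X = spectral_mat n u x" and Su: "S = spectral_mat n u s"
    by (simp_all add: sorted_joint_eigenbasis_def)
  from V have v: "orthonormal_basis n v" and Y: "Y = spectral_mat n v y" and Sv: "S = spectral_mat n v t"
    by (simp_all add: sorted_joint_eigenbasis_def)
  note shifted = sorted_joint_eigenbasis_weyl[OF U V le]
  have s_le_t: "s i \<le> t i" if i: "i < n" for i
  proof (rule ccontr)
    assume "\<not> s i \<le> t i"
    moreover have "complex_of_real (s i) \<in># proots (char_poly S)"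
      using i by (simp add: Su proots_char_poly_spectral_mat[OF u])
    moreover have "complex_of_real (t i) \<in># proots (char_poly S)"
      using i by (simp add: Sv proots_char_poly_spectral_mat[OF v])
    ultimately have "trace_norm X + trace_norm Y < K * (s i - t i)"
      using gap[of "complex_of_real (s i)" "complex_of_real (t i)"] by (simp flip: of_real_diff)
    also have "\<dots> \<le> y i - x i"
      using shifted[OF i] by (simp add: algebra_simps)
    also have "\<dots> \<le> \<bar>x i\<bar> + \<bar>y i\<bar>" by simp
    also have "\<dots> \<le> trace_norm X + trace_norm Y"
      unfolding X Y trace_norm_spectral_mat[OF u] trace_norm_spectral_mat[OF v]
      using i by (intro add_mono member_le_sum) auto
    finally show False by simp
  qed
  have "complex_of_real (\<Sum>i<n. s i) = complex_of_real (\<Sum>i<n. t i)"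
    using mat_trace_spectral_mat[OF u, of s] mat_trace_spectral_mat[OF v, of t] Su Sv by metis
  then have "(\<Sum>i<n. t i - s i) = 0"
    by (simp only: of_real_eq_iff sum_subtractf)
  then have "\<forall>i\<in>{..<n}. t i - s i = 0"
    using s_le_t by (subst sum_nonneg_eq_0_iff[symmetric]) auto
  then show "s k = t k" using k by simp
  then show "x k \<le> y k" using shifted[OF k] by simp
qed

lemma eventually_sorted_spectra_dominated:
  assumes le: "loewner_le n X Y"
  shows "\<forall>\<^sub>F K in at_top. \<forall>u x s v y t. sorted_joint_eigenbasis n K X S u x s \<longrightarrow>
    sorted_joint_eigenbasis n K Y S v y t \<longrightarrow> (\<forall>k<n. s k = t k \<and> x k \<le> y k)"
proof -
  define R where "R = set_mset (proots (char_poly S))"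
  define G where "G = (\<lambda>(a, b). cmod (a - b)) ` {(a, b) \<in> R \<times> R. a \<noteq> b}"
  define c where "c = trace_norm X + trace_norm Y"
  have "finite (R \<times> R)" by (simp add: R_def)
  then have "finite G"
    unfolding G_def by (rule finite_imageI[OF finite_subset, rotated]) auto
  moreover have "\<forall>\<^sub>F K in at_top. c < K * g" if "g \<in> G" for g
  proof -
    have "g > 0" using that by (auto simp: G_def)
    show ?thesis
      using eventually_gt_at_top[of "c / g"]
        by (rule eventually_mono) (simp add: pos_divide_less_eq[OF \<open>g > 0\<close>])
  qed
  ultimately have "\<forall>\<^sub>F K in at_top. \<forall>g\<in>G. c < K * g"
    by (intro eventually_ball_finite) auto
  then show ?thesis
  proof (rule eventually_mono)
    fix K assume gap: "\<forall>g\<in>G. c < K * g"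
    have separated: "trace_norm X + trace_norm Y < K * cmod (a - b)"
      if "a \<in># proots (char_poly S)" "b \<in># proots (char_poly S)" "a \<noteq> b" for a b
    proof -
      have "cmod (a - b) \<in> G"
        unfolding G_def using that by (intro image_eqI[where x = "(a, b)"]) (auto simp: R_def)
      with gap show ?thesis by (simp add: c_def)
    qed
    show "\<forall>u x s v y t. sorted_joint_eigenbasis n K X S u x s \<longrightarrow>
        sorted_joint_eigenbasis n K Y S v y t \<longrightarrow> (\<forall>k<n. s k = t k \<and> x k \<le> y k)"
      using sorted_spectra_dominated[OF _ _ le separated] by simp
  qed
qed

section \<open>Alignment below a common upper bound\<close>

lemma hermitian_negative_part:
  assumes "hermitian_mat n C" "hermitian_mat n S" "C * S = S * C"
  shows "\<exists>P. P * S = S * P \<and> psd_mat n P \<and> psd_mat n (C + P) \<and>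
    trace_norm C = Re (mat_trace C) + 2 * Re (mat_trace P)"
proof -
  obtain u c r where u: "orthonormal_basis n u" and C: "C = spectral_mat n u c" and S: "S = spectral_mat n u r"
    using commuting_hermitian_joint_eigenbasis[OF assms] by blast
  define P where "P = spectral_mat n u (\<lambda>i. max (- c i) 0)"
  have "P * S = S * P" by (simp add: P_def S spectral_mat_commute[OF u])
  moreover have "psd_mat n P" by (simp add: P_def psd_spectral_mat[OF u])
  moreover have "psd_mat n (C + P)" by (simp add: P_def C spectral_mat_add psd_spectral_mat[OF u])
  moreover have "trace_norm C = Re (mat_trace C) + 2 * Re (mat_trace P)"
  proof -
    have "\<bar>c i\<bar> = c i + 2 * max (- c i) 0" for i by auto
    then show ?thesis
      by (simp add: C P_def trace_norm_spectral_mat[OF u] mat_trace_spectral_mat[OF u] sum.distrib sum_distrib_left)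
  qed
  ultimately show ?thesis by blast
qed

lemma alignment_below_common_dominant:
  assumes "hermitian_mat n \<rho>" "hermitian_mat n \<rho>'" "hermitian_mat n D" "hermitian_mat n \<sigma>"
    and "\<rho> * \<sigma> = \<sigma> * \<rho>" "\<rho>' * \<sigma> = \<sigma> * \<rho>'" "D * \<sigma> = \<sigma> * D"
    and le: "loewner_le n \<rho> D" and le': "loewner_le n \<rho>' D"
  shows "\<exists>u v a b s. orthonormal_basis n u \<and> orthonormal_basis n v \<and>
    \<rho> = spectral_mat n u a \<and> \<rho>' = spectral_mat n v b \<and> \<sigma> = spectral_mat n u s \<and> \<sigma> = spectral_mat n v s \<and>
    (\<Sum>i<n. \<bar>a i - b i\<bar>) \<le> Re (2 * mat_trace D - mat_trace \<rho> - mat_trace \<rho>')"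
proof -
  obtain K where K: "\<forall>u x s v y t. sorted_joint_eigenbasis n K \<rho> \<sigma> u x s \<longrightarrow>
      sorted_joint_eigenbasis n K D \<sigma> v y t \<longrightarrow> (\<forall>k<n. s k = t k \<and> x k \<le> y k)"
    and K': "\<forall>u x s v y t. sorted_joint_eigenbasis n K \<rho>' \<sigma> u x s \<longrightarrow>
      sorted_joint_eigenbasis n K D \<sigma> v y t \<longrightarrow> (\<forall>k<n. s k = t k \<and> x k \<le> y k)"
    using eventually_happens'[OF trivial_limit_at_top_linorder
        eventually_conj[OF eventually_sorted_spectra_dominated[OF le] eventually_sorted_spectra_dominated[OF le']]]
    by blast
  obtain u a s where U: "sorted_joint_eigenbasis n K \<rho> \<sigma> u a s"
    using sorted_joint_eigenbasis_exists assms(1,4,5) by blast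
  obtain v b t where V: "sorted_joint_eigenbasis n K \<rho>' \<sigma> v b t"
    using sorted_joint_eigenbasis_exists assms(2,4,6) by blast
  obtain h d q where H: "sorted_joint_eigenbasis n K D \<sigma> h d q"
    using sorted_joint_eigenbasis_exists assms(3,4,7) by blast
  have s: "s i = t i" and a: "a i \<le> d i" and b: "b i \<le> d i" if "i < n" for i
    using K[rule_format, OF U H that] K'[rule_format, OF V H that] by simp_all
  have "(\<Sum>i<n. \<bar>a i - b i\<bar>) \<le> (\<Sum>i<n. 2 * d i - a i - b i)"
    using a b by (intro sum_mono) (simp add: abs_le_iff)
  also have "\<dots> = Re (2 * mat_trace D - mat_trace \<rho> - mat_trace \<rho>')"
    using U V H by (simp add: sorted_joint_eigenbasis_def mat_trace_spectral_mat sum_subtractf sum_distrib_left)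
  finally have "(\<Sum>i<n. \<bar>a i - b i\<bar>) \<le> Re (2 * mat_trace D - mat_trace \<rho> - mat_trace \<rho>')" .
  moreover have "\<sigma> = spectral_mat n v s"
    using V spectral_mat_cong[of n t s v] s by (simp add: sorted_joint_eigenbasis_def)
  ultimately show ?thesis
    using U V unfolding sorted_joint_eigenbasis_def by blast
qed

theorem aligned_joint_eigenbases:
  assumes H\<rho>: "hermitian_mat n \<rho>" and H\<rho>': "hermitian_mat n \<rho>'" and H\<sigma>: "hermitian_mat n \<sigma>"
    and \<rho>\<sigma>: "\<rho> * \<sigma> = \<sigma> * \<rho>" and \<rho>'\<sigma>: "\<rho>' * \<sigma> = \<sigma> * \<rho>'"
  shows "\<exists>u v a b s. orthonormal_basis n u \<and> orthonormal_basis n v \<and>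
    \<rho> = spectral_mat n u a \<and> \<rho>' = spectral_mat n v b \<and> \<sigma> = spectral_mat n u s \<and> \<sigma> = spectral_mat n v s \<and>
    (\<Sum>i<n. \<bar>a i - b i\<bar>) \<le> trace_norm (\<rho> - \<rho>')"
proof -
  have carrier: "\<rho> \<in> carrier_mat n n" "\<rho>' \<in> carrier_mat n n" "\<sigma> \<in> carrier_mat n n"
    using H\<rho> H\<rho>' H\<sigma> by (simp_all add: hermitian_mat_carrier)
  have "(\<rho> - \<rho>') * \<sigma> = \<sigma> * (\<rho> - \<rho>')"
    using carrier \<rho>\<sigma> \<rho>'\<sigma> by (simp add: minus_mult_distrib_mat[of _ n n] mult_minus_distrib_mat[of _ n n])
  then obtain P where P\<sigma>: "P * \<sigma> = \<sigma> * P" and P: "psd_mat n P" and CP: "psd_mat n (\<rho> - \<rho>' + P)"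
    and trace_P: "trace_norm (\<rho> - \<rho>') = Re (mat_trace (\<rho> - \<rho>')) + 2 * Re (mat_trace P)"
    using hermitian_negative_part[OF hermitian_mat_minus[OF H\<rho> H\<rho>'] H\<sigma>] by blast
  have HP: "hermitian_mat n P" and Pc: "P \<in> carrier_mat n n"
    using P by (simp_all add: psd_mat_def hermitian_mat_def)
  define D where "D = \<rho> + P"
  have D': "D = \<rho>' + (\<rho> - \<rho>' + P)"
    unfolding D_def using carrier Pc by (intro eq_matI) auto
  have "D * \<sigma> = \<sigma> * D"
    unfolding D_def using carrier Pc \<rho>\<sigma> P\<sigma>
    by (simp add: add_mult_distrib_mat[of _ n n] mult_add_distrib_mat[of _ n n])
  moreover have "loewner_le n \<rho> D" "loewner_le n \<rho>' D"
    unfolding D_def using loewner_le_add_psd[OF carrier(1) P] loewner_le_add_psd[OF carrier(2) CP] D'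
    by (simp_all add: D_def)
  ultimately obtain u v a b s where aligned: "orthonormal_basis n u \<and> orthonormal_basis n v \<and>
      \<rho> = spectral_mat n u a \<and> \<rho>' = spectral_mat n v b \<and> \<sigma> = spectral_mat n u s \<and> \<sigma> = spectral_mat n v s"
    and sum_le: "(\<Sum>i<n. \<bar>a i - b i\<bar>) \<le> Re (2 * mat_trace D - mat_trace \<rho> - mat_trace \<rho>')"
    using alignment_below_common_dominant[OF H\<rho> H\<rho>' hermitian_mat_add[OF H\<rho> HP] H\<sigma> \<rho>\<sigma> \<rho>'\<sigma>]
    unfolding D_def by blast
  have "Re (2 * mat_trace D - mat_trace \<rho> - mat_trace \<rho>') = trace_norm (\<rho> - \<rho>')"
    using carrier Pc by (simp add: trace_P D_def mat_trace_add mat_trace_minus)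
  with aligned sum_le show ?thesis by (metis (no_types, lifting))
qed

theorem lemma23:
  fixes n :: nat and \<rho> \<rho>' \<sigma> :: "complex mat"
  assumes "density_mat n \<rho>" and "density_mat n \<rho>'" and "density_mat n \<sigma>"
    and "\<rho> * \<sigma> = \<sigma> * \<rho>" and "\<rho>' * \<sigma> = \<sigma> * \<rho>'"
  shows "\<exists>U. unitary_mat n U \<and>
    \<rho> * unitary_channel U \<rho>' = unitary_channel U \<rho>' * \<rho> \<and>
    trace_dist \<rho> (unitary_channel U \<rho>') \<le> trace_dist \<rho> \<rho>' \<and>
    unitary_channel U \<rho>' * \<sigma> = \<sigma> * unitary_channel U \<rho>'"
proof -
  have hermitian: "hermitian_mat n \<rho>" "hermitian_mat n \<rho>'" "hermitian_mat n \<sigma>"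
    using assms(1-3) by (simp_all add: density_mat_def psd_mat_def)
  obtain u v a b s where u: "orthonormal_basis n u" and v: "orthonormal_basis n v"
    and \<rho>: "\<rho> = spectral_mat n u a" and \<rho>': "\<rho>' = spectral_mat n v b"
    and \<sigma>: "\<sigma> = spectral_mat n u s" and sum_le: "(\<Sum>i<n. \<bar>a i - b i\<bar>) \<le> trace_norm (\<rho> - \<rho>')"
    using aligned_joint_eigenbases[OF hermitian assms(4,5)] by blast
  define U where "U = basis_mat n u * mat_adjoint (basis_mat n v)"
  have channel: "unitary_channel U \<rho>' = spectral_mat n u b"
    unfolding U_def \<rho>' by (rule unitary_channel_basis_change[OF u v])
  have "trace_dist \<rho> (unitary_channel U \<rho>') = (\<Sum>i<n. \<bar>a i - b i\<bar>) / 2"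
    by (simp add: trace_dist_def channel \<rho> spectral_mat_minus trace_norm_spectral_mat[OF u])
  with sum_le have "trace_dist \<rho> (unitary_channel U \<rho>') \<le> trace_dist \<rho> \<rho>'"
    by (simp add: trace_dist_def)
  moreover have "unitary_mat n U"
    unfolding U_def by (rule unitary_basis_change[OF u v])
  moreover have "\<rho> * unitary_channel U \<rho>' = unitary_channel U \<rho>' * \<rho>"
    and "unitary_channel U \<rho>' * \<sigma> = \<sigma> * unitary_channel U \<rho>'"
    unfolding channel \<rho> \<sigma> by (simp_all add: spectral_mat_commute[OF u])
  ultimately show ?thesis by blast
qed

end
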